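(* Let $(X,\mathcal B)$ be a standard Borel space. Then $(Aut(X,\mathcal B),p)$ is a $0$-dimensional topological space.
   Context: $Aut(X,\mathcal B)$ is the group of all one-to-one Borel automorphisms of $X$. The topology $p$ on $Aut(X,\mathcal B)$ has as a base the sets $W(T;F_1,\dots,F_k)=\{S\in Aut(X,\mathcal B): SF_i=TF_i,\ i=1,\dots,k\}$, where $T\in Aut(X,\mathcal B)$, $k\ge1$ and $F_1,\dots,F_k\in\mathcal B$. A topological space is $0$-dimensional if it has a base of clopen sets. *)

theory Defs
  imports "HOL-Analysis.Analysis"
begin

definition polish_space :: "'a topology \<Rightarrow> bool" where
  "polish_space X \<longleftrightarrow> completely_metrizable_space X \<and>
     (\<exists>D. countable D \<and> D \<subseteq> topspace X \<and> X closure_of D = topspace X)"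

text \<open>A type \<open>'a measure\<close> is used only as a measurable space: the measure it carries plays no role.\<close>

definition standard_borel_space :: "'a measure \<Rightarrow> bool" where
  "standard_borel_space M \<longleftrightarrow>
     (\<exists>X. polish_space X \<and> topspace X = space M \<and>
          sets M = sigma_sets (topspace X) {U. openin X U})"

text \<open>Automorphisms are maps of the underlying set of \<open>M\<close>; membership in \<^const>\<open>extensional\<close>
  fixes their irrelevant values elsewhere, so that equal automorphisms are equal functions.\<close>

definition borel_aut :: "'a measure \<Rightarrow> ('a \<Rightarrow> 'a) set" where
  "borel_aut M = {T \<in> extensional (space M).
     bij_betw T (space M) (space M) \<and> T \<in> measurable M M \<and>
     inv_into (space M) T \<in> measurable M M}"

definition p_nbhd :: "'a measure \<Rightarrow> ('a \<Rightarrow> 'a) \<Rightarrow> nat \<Rightarrow> (nat \<Rightarrow> 'a set) \<Rightarrow> ('a \<Rightarrow> 'a) set" where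
  "p_nbhd M T k F = {S \<in> borel_aut M. \<forall>i\<in>{1..k}. S ` F i = T ` F i}"

definition p_base :: "'a measure \<Rightarrow> ('a \<Rightarrow> 'a) set set" where
  "p_base M = {p_nbhd M T k F | T k F.
     T \<in> borel_aut M \<and> k \<ge> 1 \<and> (\<forall>i\<in>{1..k}. F i \<in> sets M)}"

definition p_topology :: "'a measure \<Rightarrow> ('a \<Rightarrow> 'a) topology" where
  "p_topology M = topology (arbitrary union_of (\<lambda>U. U \<in> p_base M))"

definition zero_dimensional_space :: "'a topology \<Rightarrow> bool" where
  "zero_dimensional_space X \<longleftrightarrow>
     (\<exists>B. (\<forall>U\<in>B. openin X U \<and> closedin X U) \<and> openin X = arbitrary union_of (\<lambda>U. U \<in> B))"

lemma p_nbhd_Int: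
  assumes "R \<in> p_nbhd M T k F" "R \<in> p_nbhd M S l G"
  shows "p_nbhd M T k F \<inter> p_nbhd M S l G =
         p_nbhd M R (k + l) (\<lambda>i. if i \<le> k then F i else G (i - k))"
proof -
  have split: "(\<forall>i\<in>{1..k+l}. P i) \<longleftrightarrow> (\<forall>i\<in>{1..k}. P i) \<and> (\<forall>i\<in>{1..l}. P (i + k))"
    for P :: "nat \<Rightarrow> bool"
  proof
    assume R: "(\<forall>i\<in>{1..k}. P i) \<and> (\<forall>i\<in>{1..l}. P (i + k))"
    show "\<forall>i\<in>{1..k+l}. P i"
    proof
      fix i assume i: "i \<in> {1..k+l}"
      show "P i"
      proof (cases "i \<le> k")
        case False
        then have "i - k \<in> {1..l}" using i by auto
        then have "P (i - k + k)" using R by blast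
        then show ?thesis using False by simp
      qed (use R i in auto)
    qed
  qed auto
  show ?thesis
    using assms unfolding p_nbhd_def split by auto
qed

text \<open>The sets in \<^const>\<open>p_base\<close> do form a base of a topology on all of \<^const>\<open>borel_aut\<close>,
  so that the conversion by \<^const>\<open>topology\<close> in \<open>p_topology_def\<close> is meaningful.\<close>

lemma openin_p_topology:
  "openin (p_topology M) = arbitrary union_of (\<lambda>U. U \<in> p_base M)"
proof -
  have "(arbitrary union_of (\<lambda>U. U \<in> p_base M)) (V \<inter> W)"
    if VW: "V \<in> p_base M" "W \<in> p_base M" for V W
  proof (cases "V \<inter> W = {}")
    case False
    then obtain R where R: "R \<in> V" "R \<in> W" by auto
    obtain T k F where V: "V = p_nbhd M T k F" "k \<ge> 1" "\<forall>i\<in>{1..k}. F i \<in> sets M"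
      using VW unfolding p_base_def by auto
    obtain S l G where W: "W = p_nbhd M S l G" "l \<ge> 1" "\<forall>i\<in>{1..l}. G i \<in> sets M"
      using VW unfolding p_base_def by auto
    have "R \<in> borel_aut M" using R V by (simp add: p_nbhd_def)
    moreover have "\<forall>i\<in>{1..k+l}. (if i \<le> k then F i else G (i - k)) \<in> sets M"
    proof
      fix i assume i: "i \<in> {1..k+l}"
      show "(if i \<le> k then F i else G (i - k)) \<in> sets M"
      proof (cases "i \<le> k")
        case False
        then have "i - k \<in> {1..l}" using i by auto
        then show ?thesis using W(3) False by auto
      qed (use V(3) i in auto)
    qed
    moreover have "V \<inter> W = p_nbhd M R (k + l) (\<lambda>i. if i \<le> k then F i else G (i - k))"
      using p_nbhd_Int R V W by blast
    ultimately have "V \<inter> W \<in> p_base M"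
      using V(2) unfolding p_base_def by (intro CollectI exI[of _ R] exI[of _ "k + l"] exI) auto
    then show ?thesis by (simp add: arbitrary_union_of_inc)
  qed simp
  then have "istopology (arbitrary union_of (\<lambda>U. U \<in> p_base M))"
    by (simp add: istopology_base_eq)
  then show ?thesis by (simp add: p_topology_def)
qed

lemma topspace_p_topology: "topspace (p_topology M) = borel_aut M"
proof
  show "topspace (p_topology M) \<subseteq> borel_aut M"
    unfolding topspace_def openin_p_topology union_of_def p_base_def p_nbhd_def by blast
  show "borel_aut M \<subseteq> topspace (p_topology M)"
  proof
    fix T assume T: "T \<in> borel_aut M"
    then have "p_nbhd M T 1 (\<lambda>_. space M) \<in> p_base M"
      unfolding p_base_def by auto
    then have "openin (p_topology M) (p_nbhd M T 1 (\<lambda>_. space M))"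
      by (simp add: openin_p_topology arbitrary_union_of_inc)
    moreover have "T \<in> p_nbhd M T 1 (\<lambda>_. space M)" using T by (simp add: p_nbhd_def)
    ultimately show "T \<in> topspace (p_topology M)" using openin_subset by blast
  qed
qed

end

theory Submission
  imports Defs
begin

text \<open>The defining base is itself clopen. Finitely many Borel sets sort the automorphisms by
  the images they give these sets, and every class is basic open; hence so is the complement of a
  class open, which is \<open>closedin_p_base\<close>.\<close>

lemma openin_p_base: "U \<in> p_base M \<Longrightarrow> openin (p_topology M) U"
  by (simp add: openin_p_topology arbitrary_union_of_inc)

lemma closedin_p_base:
  assumes "U \<in> p_base M"
  shows "closedin (p_topology M) U"
proof -
  obtain T k F where U: "U = p_nbhd M T k F" "k \<ge> 1" "\<forall>i\<in>{1..k}. F i \<in> sets M"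
    using assms unfolding p_base_def by blast
  \<comment> \<open>For fixed F, the sets p_nbhd M S k F are the classes of an equivalence relation on
    the automorphisms, so the complement of one class is the union of the others.\<close>
  have "openin (p_topology M) (p_nbhd M S k F)" if "S \<in> borel_aut M" for S
    using that U by (intro openin_p_base) (auto simp: p_base_def)
  then have "openin (p_topology M) (\<Union>S\<in>borel_aut M - U. p_nbhd M S k F)"
    by (intro openin_Union) auto
  \<comment> \<open>A class that meets \<open>U\<close> has its representative \<open>S\<close> in
    \<open>U\<close>; conversely, every automorphism lies in its own class.\<close>
  also have "(\<Union>S\<in>borel_aut M - U. p_nbhd M S k F) = borel_aut M - U"
    unfolding U(1) p_nbhd_def by (intro equalityI subsetI) (force, blast)
  finally have "openin (p_topology M) (borel_aut M - U)" .
  moreover have "U \<subseteq> borel_aut M"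
    by (auto simp: U(1) p_nbhd_def)
  ultimately show ?thesis
    by (simp add: closedin_def topspace_p_topology)
qed

theorem corollary1p11:
  fixes M :: "'a measure"
  assumes "standard_borel_space M"
  shows "zero_dimensional_space (p_topology M)"
  unfolding zero_dimensional_space_def
proof (intro exI conjI ballI)
  \<comment> \<open>Proved first because it instantiates the unknown base to
    \<open>p_base M\<close>.\<close>
  show "openin (p_topology M) = arbitrary union_of (\<lambda>U. U \<in> p_base M)"
    by (rule openin_p_topology)
qed (auto intro: openin_p_base closedin_p_base)

end
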